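(* Let $c>0$ be the fixed constant used in the splitting procedure and let $c_0\ge 1$. There exist constants $0<c_1,c_2<1$ (depending only on $c$ and $c_0$, and not on the ambient dimension $D$, on $d$, or on the data) with the following property. Let $\mathbf{X}\subset\mathcal{X}\subset\mathbb{R}^D$ be a finite data set and let $A\subset\mathcal{X}$ be a cell with $\Delta_a(A)>0$. Suppose $\Delta^2(A)\le c\cdot\Delta_a^2(A)$, so that $A$ is split by projection into $\mathbf{A}=\{A_1,A_2\}$ using the 2Mtree split. Assume $A\cap\mathbf{X}$ has covariance dimension $(d,c_1)$ with $d\geq 1$, let $\lambda_1\ge\cdots\ge\lambda_D$ be the eigenvalues of the covariance matrix of $A\cap\mathbf{X}$, and let $k=\frac{1}{\lambda_1}\sum_{i=1}^d\lambda_i$. Then $$\Delta_a^2(\mathbf{A})<\left(1-\frac{c_2}{d'}\right)\Delta_a^2(A)$$ for some $d'>0$ with $d'\le\min\{d,k^2\}$. Moreover, if the empirical distribution on $A\cap\mathbf{X}$ satisfies, for every $s\in\mathbb{R}$, $$\mathbb{E}_A\left[(X\cdot v-s)^2\right]\le c_0\left(\mathbb{E}_A\left[\,|X\cdot v-s|\,\right]\right)^2,$$ where $v$ is the principal eigenvector of the covariance matrix of $A\cap\mathbf{X}$ and $\mathbb{E}_A$ denotes expectation over $X$ drawn uniformly from $A\cap\mathbf{X}$, then the inequality holds for some $d'>0$ with $d'\le k$.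
   Context: $\mathbf{X}=\{X_1,\dots,X_n\}$ is a data set drawn from $\mathcal{X}\subset\mathbb{R}^D$, and $\mu$ is the empirical distribution giving weight $1/n$ to each data point. For a cell $A$ (a subset of $\mathcal{X}$), with $n\mu(A)=|A\cap\mathbf{X}|$, define the maximum and average data diameters $$\Delta(A)=\max_{x,x'\in A\cap\mathbf{X}}\|x-x'\|,\qquad \Delta_a(A)=\frac{1}{n\mu(A)}\Big(\sum_{x,x'\in A\cap\mathbf{X}}\|x-x'\|^2\Big)^{1/2},$$ where the sum is over ordered pairs and $\|\cdot\|$ is the Euclidean norm. For a collection $\mathbf{A}$ of disjoint cells, $$\Delta_a(\mathbf{A})=\left(\frac{\sum_{A\in\mathbf{A}}\mu(A)\Delta_a^2(A)}{\sum_{A\in\mathbf{A}}\mu(A)}\right)^{1/2}.$$ Covariance dimension: a measure on $\mathbb{R}^D$ whose covariance matrix has eigenvalues $\lambda_1\ge\cdots\ge\lambda_D$ has covariance dimension $(d,\epsilon)$ if $\lambda_1+\cdots+\lambda_d\ge(1-\epsilon)(\lambda_1+\cdots+\lambda_D)$. "$A\cap\mathbf{X}$ has covariance dimension $(d,\epsilon)$" means that the uniform distribution on the data points in $A$ does; the covariance matrix of $A\cap\mathbf{X}$ is the covariance matrix of that distribution. 2Mtree split by projection (assuming an exact 2-means solver): $\{A_1,A_2\}$ is the bisection of $A$ that minimizes the 2-means cost $$\sum_{i=1}^{2}\ \sum_{x\in A_i\cap\mathbf{X}}\|x-\mathrm{mean}(A_i)\|^2$$ over all bisections of the data in $A$,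 where $\mathrm{mean}(A_i)$ is the mean of the data points in $A_i$. It is realized as a projection split along the direction $\mathrm{mean}(A_1)-\mathrm{mean}(A_2)$, with threshold at the half point between the two means. *)

theory Defs
  imports "HOL-Probability.Probability" "Jordan_Normal_Form.Spectral_Radius"
begin

unbundle no vec_syntax
unbundle no inner_syntax

text \<open>
  Points of $D$-dimensional Euclidean space are elements of \<open>carrier_vec D\<close>, so that \<open>D\<close> is an
  ordinary natural number and constants can be required not to depend on it.
\<close>

definition vnorm :: "real vec \<Rightarrow> real" where
  "vnorm x = sqrt (x \<bullet> x)"


subsection \<open>Diameters\<close>

definition max_diam :: "real vec set \<Rightarrow> real vec set \<Rightarrow> real" where
  "max_diam X A = Max ((\<lambda>(x, x'). vnorm (x - x')) ` ((A \<inter> X) \<times> (A \<inter> X)))"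

definition avg_diam :: "real vec set \<Rightarrow> real vec set \<Rightarrow> real" where
  "avg_diam X A =
     1 / real (card (A \<inter> X)) * sqrt (\<Sum>(x, x') \<in> (A \<inter> X) \<times> (A \<inter> X). (vnorm (x - x'))\<^sup>2)"

text \<open>The weight of a cell is its mass under the empirical distribution \<open>pmf_of_set X\<close>.\<close>

definition avg_diam_coll :: "real vec set \<Rightarrow> real vec set set \<Rightarrow> real" where
  "avg_diam_coll X \<A> =
     sqrt ((\<Sum>A\<in>\<A>. measure_pmf.prob (pmf_of_set X) A * (avg_diam X A)\<^sup>2) /
           (\<Sum>A\<in>\<A>. measure_pmf.prob (pmf_of_set X) A))"


subsection \<open>Covariance dimension\<close>

definition mean_vec :: "nat \<Rightarrow> real vec pmf \<Rightarrow> real vec" where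
  "mean_vec D p = vec D (\<lambda>i. measure_pmf.expectation p (\<lambda>x. x $ i))"

definition cov_mat :: "nat \<Rightarrow> real vec pmf \<Rightarrow> real mat" where
  "cov_mat D p = mat D D (\<lambda>(i, j). measure_pmf.expectation p
     (\<lambda>x. (x $ i - mean_vec D p $ i) * (x $ j - mean_vec D p $ j)))"

text \<open>
  Real eigenvalues, repeated according to their algebraic multiplicity, in decreasing order. For a
  real symmetric \<open>D \<times> D\<close> matrix this list has length \<open>D\<close>; its entry number \<open>i\<close>, counted from
  \<open>0\<close>, is $\lambda_{i+1}$.
\<close>

definition eigvals_desc :: "real mat \<Rightarrow> real list" where
  "eigvals_desc M = rev (sorted_list_of_multiset (proots (char_poly M)))"

text \<open>The bound \<open>d \<le> D\<close> is what gives $\lambda_1 + \dots + \lambda_d$ a meaning.\<close>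

definition has_cov_dim :: "nat \<Rightarrow> real vec pmf \<Rightarrow> nat \<Rightarrow> real \<Rightarrow> bool" where
  "has_cov_dim D p d \<epsilon> \<longleftrightarrow> d \<le> D \<and>
     (let ev = eigvals_desc (cov_mat D p)
      in (\<Sum>i<d. ev ! i) \<ge> (1 - \<epsilon>) * (\<Sum>i<D. ev ! i))"


subsection \<open>The 2-means split\<close>

definition bisection :: "'a set \<Rightarrow> 'a set \<Rightarrow> 'a set \<Rightarrow> bool" where
  "bisection S S\<^sub>1 S\<^sub>2 \<longleftrightarrow> S\<^sub>1 \<union> S\<^sub>2 = S \<and> S\<^sub>1 \<inter> S\<^sub>2 = {} \<and> S\<^sub>1 \<noteq> {} \<and> S\<^sub>2 \<noteq> {}"

definition data_mean :: "nat \<Rightarrow> real vec set \<Rightarrow> real vec" where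
  "data_mean D S = mean_vec D (pmf_of_set S)"

definition two_means_cost :: "nat \<Rightarrow> real vec set \<Rightarrow> real vec set \<Rightarrow> real" where
  "two_means_cost D S\<^sub>1 S\<^sub>2 =
     (\<Sum>x\<in>S\<^sub>1. (vnorm (x - data_mean D S\<^sub>1))\<^sup>2) + (\<Sum>x\<in>S\<^sub>2. (vnorm (x - data_mean D S\<^sub>2))\<^sup>2)"

text \<open>
  The two cells are separated by the hyperplane that is orthogonal to the difference of the two
  means and passes through their midpoint. Points of the cell lying on this hyperplane may be
  assigned to either side.
\<close>

definition two_means_split ::
  "nat \<Rightarrow> real vec set \<Rightarrow> real vec set \<Rightarrow> real vec set \<Rightarrow> real vec set \<Rightarrow> bool" where
  "two_means_split D X A A\<^sub>1 A\<^sub>2 \<longleftrightarrow>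
     A\<^sub>1 \<union> A\<^sub>2 = A \<and> A\<^sub>1 \<inter> A\<^sub>2 = {} \<and>
     bisection (A \<inter> X) (A\<^sub>1 \<inter> X) (A\<^sub>2 \<inter> X) \<and>
     (\<forall>S\<^sub>1 S\<^sub>2. bisection (A \<inter> X) S\<^sub>1 S\<^sub>2 \<longrightarrow>
        two_means_cost D (A\<^sub>1 \<inter> X) (A\<^sub>2 \<inter> X) \<le> two_means_cost D S\<^sub>1 S\<^sub>2) \<and>
     (let m\<^sub>1 = data_mean D (A\<^sub>1 \<inter> X); m\<^sub>2 = data_mean D (A\<^sub>2 \<inter> X);
          w = m\<^sub>1 - m\<^sub>2; \<theta> = (m\<^sub>1 \<bullet> w + m\<^sub>2 \<bullet> w) / 2
      in (\<forall>x\<in>A\<^sub>1. x \<bullet> w \<ge> \<theta>) \<and> (\<forall>x\<in>A\<^sub>2. x \<bullet> w \<le> \<theta>))"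

end

theory Submission
  imports Defs
begin

text \<open>
  Let $V = \sum_i \lambda_i$ be the mean squared distance of the data in the cell to their mean
  $m$. Then $\Delta_a^2(A) = 2V$, and $\Delta_a^2(\mathbf{A})$ is twice the 2-means cost per data
  point. For a direction $u$, splitting the data by the sign of $u \cdot (x - m)$ and using the
  centres $m \pm b u$ with the best $b$ shows that the optimal split lowers the cost per point by at
  least $(E|u \cdot (x - m)|)^2 / |u|^2$. It remains to find directions with a large mean absolute
  deviation, and the bound $|x - m|^2 \le 2cV$ converts second moments into first moments. The
  principal eigenvector gives the rates $1/k^2$ and, under the moment hypothesis, $1/k$. For the
  rate $1/d$, take $u = \sum_{i<d} \pm e_i$ with random signs and the first $d$ principal
  directions $e_i$, and bound the first absolute moment below through the second and fourth ones.
\<close>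

subsection \<open>Orthonormal eigenbases of real symmetric matrices\<close>

text \<open>Reduces the conjugated product \<open>\<bullet>c\<close> to \<open>\<bullet>\<close> for
  real vectors, so that facts about complex inner products apply.\<close>

lemma conjugate_real_vec [simp]: "conjugate (v :: real vec) = v"
  by (rule eq_vecI) auto

text \<open>Complete \<open>v\<close> to a basis, apply Gram-Schmidt, which keeps the first vector,
  and divide every vector by its length.\<close>

lemma normalized_orthogonal_completion:
  fixes v :: "real vec"
  assumes v: "v \<in> carrier_vec n" "v \<noteq> 0\<^sub>v n"
  obtains W where "W \<in> carrier_mat n n" "transpose_mat W * W = 1\<^sub>m n"
    "col W 0 = (1 / sqrt (v \<bullet> v)) \<cdot>\<^sub>v v"
proof -
  interpret cof_vec_space n "TYPE(real)" .
  define b where "b = basis_completion v"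
  define ws where "ws = gram_schmidt n b"
  have b: "span (set b) = carrier_vec n" "distinct b" "\<not> lin_dep (set b)"
    "set b \<subseteq> carrier_vec n" "hd b = v" "length b = n"
    using basis_completion[OF v] by (auto simp: b_def)
  have n: "n \<noteq> 0"
    using v by (auto intro: eq_vecI)
  then obtain vs where bv: "b = v # vs"
    using b by (cases b) auto
  have ws: "set ws \<subseteq> carrier_vec n" "corthogonal ws" "length ws = n"
    using gram_schmidt_result[OF b(4,2,3) refl, folded ws_def] b(6) by auto
  have hdws: "hd ws = v"
    using gram_schmidt_hd[OF v(1), of vs, folded bv] by (simp add: ws_def)
  define W where "W = mat n n (\<lambda>(i, j). (ws ! j) $ i / sqrt (ws ! j \<bullet> ws ! j))"
  have wsc: "ws ! j \<in> carrier_vec n" if "j < n" for j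
    using ws that nth_mem by blast
  \<comment> \<open>\<open>corthogonal\<close> also excludes isotropic vectors: the product vanishes
    exactly for distinct indices, so every length divided by is positive.\<close>
  have orth: "ws ! i \<bullet> ws ! j = 0 \<longleftrightarrow> i \<noteq> j" if "i < n" "j < n" for i j
    using corthogonalD[OF ws(2)] that ws(3) by simp
  have pos: "ws ! i \<bullet> ws ! i > 0" if "i < n" for i
    using orth[OF that that] by (simp add: scalar_prod_def order_less_le sum_nonneg)
  show ?thesis
  proof
    show "W \<in> carrier_mat n n" by (simp add: W_def)
    show "transpose_mat W * W = 1\<^sub>m n"
    proof (rule eq_matI)
      fix i j assume ij: "i < dim_row (1\<^sub>m n :: real mat)" "j < dim_col (1\<^sub>m n :: real mat)"
      have "(transpose_mat W * W) $$ (i, j)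
          = (\<Sum>k<n. (ws ! i) $ k * (ws ! j) $ k) / (sqrt (ws ! i \<bullet> ws ! i) * sqrt (ws ! j \<bullet> ws ! j))"
        using ij by (simp add: W_def scalar_prod_def sum_divide_distrib atLeast0LessThan)
      also have "(\<Sum>k<n. (ws ! i) $ k * (ws ! j) $ k) = ws ! i \<bullet> ws ! j"
        using wsc[of j] ij by (simp add: scalar_prod_def atLeast0LessThan)
      also have "\<dots> / (sqrt (ws ! i \<bullet> ws ! i) * sqrt (ws ! j \<bullet> ws ! j)) = 1\<^sub>m n $$ (i, j)"
        using orth[of i j] pos[of i] ij by (cases "i = j") (auto simp: W_def)
      finally show "(transpose_mat W * W) $$ (i, j) = 1\<^sub>m n $$ (i, j)" .
    qed (auto simp: W_def)
    have "ws ! 0 = v"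
      using hdws n ws(3) by (cases ws) auto
    then show "col W 0 = (1 / sqrt (v \<bullet> v)) \<cdot>\<^sub>v v"
      using n v by (intro eq_vecI) (auto simp: W_def)
  qed
qed

text \<open>Induction by deflation: an orthogonal change of basis starting with an eigenvector for
  the first root splits off a block of size 1, and the remaining block is symmetric with the
  remaining roots. The order of \<open>es\<close> is preserved on the diagonal, so a decreasing
  order can be prescribed later.\<close>

lemma symmetric_diagonalization:
  fixes A :: "real mat"
  assumes "A \<in> carrier_mat n n" "transpose_mat A = A" "char_poly A = (\<Prod>e\<leftarrow>es. [:- e, 1:])"
  shows "\<exists>B P. similar_mat_wit A B P (transpose_mat P) \<and> diagonal_mat B \<and> diag_mat B = es"
  using assms
proof (induction es arbitrary: n A)
  case Nil
  \<comment> \<open>The empty product has degree 0 while the characteristic polynomial has degree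
    \<open>n\<close>, so \<open>n = 0\<close>.\<close>
  with degree_monic_char_poly[of A n] show ?case
    by (intro exI[of _ A] exI[of _ "1\<^sub>m n"])
      (auto simp: diag_mat_def diagonal_mat_def intro: similar_mat_wit_refl)
next
  case (Cons e es n A)
  note A = Cons.prems(1)
  have cp: "char_poly A = [:- e, 1:] * (\<Prod>e\<leftarrow>es. [:- e, 1:])"
    using Cons.prems by simp
  have e: "eigenvalue A e"
    unfolding eigenvalue_root_char_poly[OF A] cp by simp
  then obtain v where v: "v \<in> carrier_vec n" "v \<noteq> 0\<^sub>v n" and Av: "A *\<^sub>v v = e \<cdot>\<^sub>v v"
    using A by (auto simp: eigenvalue_def eigenvector_def)
  have n: "n \<noteq> 0"
    using v by (auto intro: eq_vecI)
  define m where "m = n - 1"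
  have nm: "n = 1 + m" using n by (simp add: m_def)
  obtain W where W: "W \<in> carrier_mat n n" and WW: "transpose_mat W * W = 1\<^sub>m n"
    and W0: "col W 0 = (1 / sqrt (v \<bullet> v)) \<cdot>\<^sub>v v"
    using normalized_orthogonal_completion[OF v] .
  have Wt: "transpose_mat W \<in> carrier_mat n n" using W by simp
  have WW': "W * transpose_mat W = 1\<^sub>m n"
    using mat_mult_left_right_inverse[OF Wt W WW] .
  define A' where "A' = transpose_mat W * A * W"
  have A': "A' \<in> carrier_mat n n" using W A by (simp add: A'_def)
  have A'A: "similar_mat_wit A' A (transpose_mat W) W"
    by (rule similar_mat_witI[of _ _ n]) (use W A A' WW WW' in \<open>auto simp: A'_def\<close>)
  have A'_sym: "transpose_mat A' = A'"
  proof -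
    have "transpose_mat A' = transpose_mat W * transpose_mat (transpose_mat W * A)"
      unfolding A'_def by (rule transpose_mult) (use W A in auto)
    also have "transpose_mat (transpose_mat W * A) = A * W"
      using transpose_mult[OF Wt A] Cons.prems(2) by simp
    also have "transpose_mat W * (A * W) = A'"
      unfolding A'_def using assoc_mult_mat[OF Wt A W] by simp
    finally show ?thesis .
  qed
  have A'_swap: "A' $$ (i, j) = A' $$ (j, i)" if "i < n" "j < n" for i j
    using arg_cong[OF A'_sym, of "\<lambda>M. M $$ (i, j)"] that A' by simp
  have col0: "A' $$ (i, 0) = (if i = 0 then e else 0)" if "i < n" for i
  proof -
    have "A * W \<in> carrier_mat n n" using A W by simp
    have "A' $$ (i, 0) = (transpose_mat W * (A * W)) $$ (i, 0)"
      unfolding A'_def using assoc_mult_mat[OF Wt A W] by simp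
    also have "\<dots> = col W i \<bullet> col (A * W) 0"
      using that n A W by simp
    also have "col (A * W) 0 = A *\<^sub>v col W 0"
      using A W n by (intro eq_vecI) auto
    also have "\<dots> = e \<cdot>\<^sub>v col W 0"
      unfolding W0 using Av A v by (simp add: mult_mat_vec smult_smult_assoc mult.commute)
    also have "col W i \<bullet> (e \<cdot>\<^sub>v col W 0) = e * (transpose_mat W * W) $$ (i, 0)"
      using that n W by simp
    finally show ?thesis using WW that n by simp
  qed
  define A1 where "A1 = mat 1 1 (\<lambda>_. e)"
  define A3 where "A3 = mat m m (\<lambda>(i, j). A' $$ (Suc i, Suc j))"
  have A1: "A1 \<in> carrier_mat 1 1" and A3: "A3 \<in> carrier_mat m m"
    by (auto simp: A1_def A3_def)
  \<comment> \<open>Column 0 is known from the eigenvector, and symmetry transfers its zeros to row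
    0.\<close>
  have block: "A' = four_block_mat A1 (0\<^sub>m 1 m) (0\<^sub>m m 1) A3"
  proof (rule eq_matI)
    fix i j assume "i < dim_row (four_block_mat A1 (0\<^sub>m 1 m) (0\<^sub>m m 1) A3)"
      "j < dim_col (four_block_mat A1 (0\<^sub>m 1 m) (0\<^sub>m m 1) A3)"
    then have ij: "i < n" "j < n" using A1 A3 nm by auto
    show "A' $$ (i, j) = four_block_mat A1 (0\<^sub>m 1 m) (0\<^sub>m m 1) A3 $$ (i, j)"
      using ij col0[of i] col0[of j] A'_swap[of i j] nm
      by (cases i; cases j) (auto simp: A1_def A3_def)
  qed (use A' A1 A3 nm in auto)
  have "char_poly A' = char_poly A1 * char_poly A3"
    unfolding block by (rule char_poly_four_block_zeros_col[OF A1 _ A3]) simp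
  moreover have "char_poly A1 = [:- e, 1:]"
    by (simp add: A1_def char_poly_defs det_def sign_def)
  moreover have "char_poly A' = char_poly A"
    using A'A by (intro char_poly_similar) (auto simp: similar_mat_def)
  \<comment> \<open>Cancelling the nonzero factor that belongs to \<open>e\<close> leaves exactly
    the roots \<open>es\<close> for the smaller block.\<close>
  ultimately have cp3: "char_poly A3 = (\<Prod>e\<leftarrow>es. [:- e, 1:])"
    using cp by (metis mult_cancel_left pCons_eq_0_iff zero_neq_one)
  have "transpose_mat A3 = A3"
    by (rule eq_matI) (auto simp: A3_def nm intro!: A'_swap)
  from Cons.IH[OF A3 this cp3] obtain B P where
    sim: "similar_mat_wit A3 B P (transpose_mat P)" and B: "diagonal_mat B" "diag_mat B = es"
    by blast
  note simD = similar_mat_witD2[OF A3 sim]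
  define C where "C = four_block_mat A1 (0\<^sub>m 1 m) (0\<^sub>m m 1) B"
  define R where "R = four_block_mat (1\<^sub>m 1) (0\<^sub>m 1 m) (0\<^sub>m m 1) P"
  have R: "R \<in> carrier_mat n n" using simD nm by (auto simp: R_def)
  have Rt: "transpose_mat R = four_block_mat (1\<^sub>m 1) (0\<^sub>m 1 m) (0\<^sub>m m 1) (transpose_mat P)"
    unfolding R_def using simD by (subst transpose_four_block_mat) (auto simp: transpose_one)
  have "similar_mat_wit A' C R (transpose_mat R)"
    unfolding block C_def R_def Rt[unfolded R_def]
    by (rule similar_mat_wit_four_block[OF similar_mat_wit_refl[OF A1] sim _ _ A1 A3])
      (use simD in auto)
  from similar_mat_wit_trans[OF similar_mat_wit_sym[OF A'A] this]
  have "similar_mat_wit A C (W * R) (transpose_mat (W * R))"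
    using transpose_mult[OF W R] by simp
  moreover have "diagonal_mat C"
    using B(1) simD by (auto simp: C_def diagonal_mat_def A1_def)
  moreover have "diag_mat C = e # es"
    using diag_four_block_mat[OF A1, of B m] simD B(2) by (simp add: C_def A1_def diag_mat_def)
  ultimately show ?case by blast
qed

text \<open>The polynomial factors over the complex numbers. Moving the matrix from one side of the
  inner product to the other shows that each root equals its conjugate, so the factorization is
  real.\<close>

lemma char_poly_symmetric_splits:
  fixes A :: "real mat"
  assumes A: "A \<in> carrier_mat n n" and sym: "transpose_mat A = A"
  shows "\<exists>es. char_poly A = (\<Prod>e\<leftarrow>es. [:- e, 1:]) \<and> length es = n"
proof -
  define B where "B = map_mat complex_of_real A"
  have B: "B \<in> carrier_mat n n" using A by (simp add: B_def)
  obtain as where as: "char_poly B = (\<Prod>a\<leftarrow>as. [:- a, 1:])" "length as = n"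
    using char_poly_factorized[OF B] by blast
  have "complex_of_real (Re a) = a" if "a \<in> set as" for a
  proof -
    have "poly (char_poly B) a = 0"
      using that by (auto simp: as(1) poly_prod_list prod_list_zero_iff)
    then obtain v where v: "v \<in> carrier_vec n" "v \<noteq> 0\<^sub>v n" "B *\<^sub>v v = a \<cdot>\<^sub>v v"
      using eigenvalue_root_char_poly[OF B] B by (auto simp: eigenvalue_def eigenvector_def)
    have Bc: "B *\<^sub>v conjugate v = conjugate (B *\<^sub>v v)"
      using v(1) A by (intro eq_vecI) (auto simp: B_def scalar_prod_def)
    have Bt: "transpose_mat B = B"
    proof -
      have "transpose_mat B = map_mat complex_of_real (transpose_mat A)"
        by (auto simp: B_def)
      then show ?thesis by (simp add: sym B_def)
    qed
    have "a * (v \<bullet>c v) = (B *\<^sub>v v) \<bullet>c v"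
      using v by simp
    also have "\<dots> = v \<bullet> (B *\<^sub>v conjugate v)"
      using transpose_vec_mult_scalar[OF B, of "conjugate v" v] v(1) Bt comm_scalar_prod B by simp
    also have "\<dots> = cnj a * (v \<bullet>c v)"
      unfolding Bc v(3) using v by (simp add: conjugate_smult_vec)
    finally have "a = cnj a"
      using conjugate_square_eq_0_vec[OF v(1)] v(2) by simp
    then show ?thesis
      by (simp add: complex_eq_iff)
  qed
  then have "map (complex_of_real \<circ> Re) as = as"
    by (induction as) auto
  moreover have "map_poly complex_of_real (char_poly A) = char_poly B"
    unfolding B_def by (rule of_real_hom.char_poly_hom[OF A, symmetric])
  ultimately have "map_poly complex_of_real (char_poly A)
      = (\<Prod>a\<leftarrow>map (complex_of_real \<circ> Re) as. [:- a, 1:])"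
    by (simp only: as(1))
  also have "\<dots> = map_poly complex_of_real (\<Prod>e\<leftarrow>map Re as. [:- e, 1:])"
  proof (induction as)
    case (Cons a as)
    interpret map_poly_comm_ring_hom complex_of_real ..
    show ?case
      using Cons by (simp add: hom_mult del: mult_pCons_left)
  qed simp
  \<comment> \<open>The embedding of the reals is injective on coefficients, so the identity
    descends from the complex polynomials.\<close>
  finally have "char_poly A = (\<Prod>e\<leftarrow>map Re as. [:- e, 1:])"
    by (intro poly_eqI) (metis of_real_hom.coeff_map_poly_hom of_real_eq_iff)
  then show ?thesis using as(2) by (intro exI[of _ "map Re as"]) simp
qed

text \<open>Makes \<open>eigvals_desc\<close> a rearrangement of any list of roots that splits the
  characteristic polynomial.\<close>

lemma proots_linear_factors:
  fixes es :: "real list"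
  shows "proots (\<Prod>e\<leftarrow>es. [:- e, 1:]) = mset es"
proof (induction es)
  case (Cons e es)
  have "(\<Prod>e\<leftarrow>es. [:- e, 1:]) \<noteq> 0"
    by (auto simp: prod_list_zero_iff)
  with Cons show ?case
    by (simp add: proots_mult del: mult_pCons_left)
qed simp

lemma sorted_eigvals_desc: "sorted_wrt (\<ge>) (eigvals_desc M)"
  by (simp add: eigvals_desc_def sorted_wrt_rev)

lemma eigvals_desc_symmetric:
  fixes A :: "real mat"
  assumes "A \<in> carrier_mat n n" "transpose_mat A = A"
  shows "length (eigvals_desc A) = n" "char_poly A = (\<Prod>e\<leftarrow>eigvals_desc A. [:- e, 1:])"
proof -
  obtain es where es: "char_poly A = (\<Prod>e\<leftarrow>es. [:- e, 1:])" "length es = n"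
    using char_poly_symmetric_splits[OF assms] by blast
  then have ms: "mset (eigvals_desc A) = mset es"
    by (simp add: eigvals_desc_def proots_linear_factors)
  show "length (eigvals_desc A) = n"
    using es(2) mset_eq_length[OF ms] by simp
  have "prod_mset (image_mset (\<lambda>e. [:- e, 1:]) (mset (eigvals_desc A)))
      = prod_mset (image_mset (\<lambda>e. [:- e, 1:]) (mset es))"
    by (simp only: ms)
  then show "char_poly A = (\<Prod>e\<leftarrow>eigvals_desc A. [:- e, 1:])"
    unfolding es(1) by (simp flip: mset_map add: prod_mset_prod_list)
qed

text \<open>The vectors are the columns of the diagonalizing matrix \<open>P\<close>. That
  \<open>P\<close> has its transpose as left inverse gives orthonormality; that the transpose is
  also a right inverse gives the Parseval identity.\<close>

lemma orthonormal_eigenbasis: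
  fixes A :: "real mat"
  assumes A: "A \<in> carrier_mat n n" and sym: "transpose_mat A = A"
  obtains b where
    "\<And>i. i < n \<Longrightarrow> b i \<in> carrier_vec n"
    "\<And>i j. i < n \<Longrightarrow> j < n \<Longrightarrow> b i \<bullet> b j = (if i = j then 1 else 0)"
    "\<And>i. i < n \<Longrightarrow> A *\<^sub>v b i = eigvals_desc A ! i \<cdot>\<^sub>v b i"
    "\<And>x. x \<in> carrier_vec n \<Longrightarrow> x \<bullet> x = (\<Sum>i<n. (b i \<bullet> x)\<^sup>2)"
proof -
  obtain B P where sim: "similar_mat_wit A B P (transpose_mat P)"
    and B: "diagonal_mat B" "diag_mat B = eigvals_desc A"
    using symmetric_diagonalization[OF A sym eigvals_desc_symmetric(2)[OF A sym]] by blast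
  note D = similar_mat_witD2[OF A sim]
  have Bij: "B $$ (i, j) = (if i = j then eigvals_desc A ! i else 0)" if "i < n" "j < n" for i j
    using B that D(5) unfolding B(2)[symmetric] by (auto simp: diagonal_mat_def diag_mat_def)
  have P: "P \<in> carrier_mat n n" and Pt: "transpose_mat P \<in> carrier_mat n n"
    and Bc: "B \<in> carrier_mat n n"
    using D by auto
  have AP: "A * P = P * B"
  proof -
    have "A * P = P * B * transpose_mat P * P" using D(3) by simp
    also have "\<dots> = P * B * (transpose_mat P * P)"
      by (rule assoc_mult_mat) (use P Bc in auto)
    finally show ?thesis using D(2) P Bc by simp
  qed
  show ?thesis
  proof (rule that[of "col P"])
    show "col P i \<in> carrier_vec n" if "i < n" for i
      using P by auto
    show "col P i \<bullet> col P j = (if i = j then 1 else 0)" if "i < n" "j < n" for i j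
      using arg_cong[OF D(2), of "\<lambda>M. M $$ (i, j)"] that P by simp
    show "A *\<^sub>v col P i = eigvals_desc A ! i \<cdot>\<^sub>v col P i" if i: "i < n" for i
    proof -
      have "A *\<^sub>v col P i = col (A * P) i"
        using A P i by (intro eq_vecI) auto
      also have "\<dots> = col (P * B) i" by (simp add: AP)
      also have "\<dots> = eigvals_desc A ! i \<cdot>\<^sub>v col P i"
      proof (rule eq_vecI)
        fix k assume "k < dim_vec (eigvals_desc A ! i \<cdot>\<^sub>v col P i)"
        then have k: "k < n" using P by simp
        have "col (P * B) i $ k = (\<Sum>l<n. P $$ (k, l) * B $$ (l, i))"
          using P Bc i k by (simp add: scalar_prod_def atLeast0LessThan)
        also have "\<dots> = (\<Sum>l<n. if l = i then P $$ (k, i) * eigvals_desc A ! i else 0)"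
          by (rule sum.cong) (use i in \<open>auto simp: Bij\<close>)
        finally show "col (P * B) i $ k = (eigvals_desc A ! i \<cdot>\<^sub>v col P i) $ k"
          using i k P by (simp add: sum.delta')
      qed (use P Bc in auto)
      finally show ?thesis .
    qed
    show "x \<bullet> x = (\<Sum>i<n. (col P i \<bullet> x)\<^sup>2)" if x: "x \<in> carrier_vec n" for x
    proof -
      have "(\<Sum>i<n. (col P i \<bullet> x)\<^sup>2) = (transpose_mat P *\<^sub>v x) \<bullet> (transpose_mat P *\<^sub>v x)"
        using P by (simp add: scalar_prod_def[of "transpose_mat P *\<^sub>v x"] atLeast0LessThan power2_eq_square)
      also have "\<dots> = x \<bullet> (P *\<^sub>v (transpose_mat P *\<^sub>v x))"
        by (rule transpose_vec_mult_scalar[OF P _ x]) (use P x in auto)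
      also have "P *\<^sub>v (transpose_mat P *\<^sub>v x) = x"
        using assoc_mult_mat_vec[OF P Pt x] D(1) x by simp
      finally show ?thesis by simp
    qed
  qed
qed

subsection \<open>Scatter around the mean and the 2-means cost\<close>

lemma vnorm_power2: "(vnorm x)\<^sup>2 = (x \<bullet> x :: real)"
  by (simp add: vnorm_def scalar_prod_def sum_nonneg)

lemma vnorm_diff_power2:
  assumes "x \<in> carrier_vec n" "y \<in> carrier_vec n"
  shows "(vnorm (x - y))\<^sup>2 = (\<Sum>i<n. (x $ i - y $ i)\<^sup>2)"
  unfolding vnorm_power2 using assms
  by (simp add: scalar_prod_def power2_eq_square atLeast0LessThan)

lemma vnorm_diff_shift:
  assumes "x \<in> carrier_vec n" "y \<in> carrier_vec n" "u \<in> carrier_vec n"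
  shows "(vnorm (x - (y + b \<cdot>\<^sub>v u)))\<^sup>2 = (vnorm (x - y))\<^sup>2 - 2 * b * (u \<bullet> (x - y)) + b\<^sup>2 * (u \<bullet> u)"
proof -
  have "(vnorm (x - (y + b \<cdot>\<^sub>v u)))\<^sup>2
      = (\<Sum>i<n. (x $ i - y $ i)\<^sup>2 - 2 * b * (u $ i * (x $ i - y $ i)) + b\<^sup>2 * (u $ i * u $ i))"
    using assms by (subst vnorm_diff_power2[where n = n])
      (auto intro!: sum.cong simp: power2_eq_square algebra_simps)
  also have "\<dots> = (vnorm (x - y))\<^sup>2 - 2 * b * (u \<bullet> (x - y)) + b\<^sup>2 * (u \<bullet> u)"
    using assms
    by (simp add: vnorm_diff_power2[where n = n] sum.distrib sum_subtractf sum_distrib_left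
        scalar_prod_def atLeast0LessThan)
  finally show ?thesis .
qed

text \<open>The cost of a single cluster. It is not divided by the number of points, so that the
  costs of two cells add up.\<close>

definition scatter :: "nat \<Rightarrow> real vec set \<Rightarrow> real" where
  "scatter D S = (\<Sum>x\<in>S. (vnorm (x - data_mean D S))\<^sup>2)"

lemma two_means_cost_scatter: "two_means_cost D S T = scatter D S + scatter D T"
  by (simp add: two_means_cost_def scatter_def)

lemma data_mean_carrier [simp]: "data_mean D S \<in> carrier_vec D"
  by (simp add: data_mean_def mean_vec_def)

lemma dim_data_mean [simp]: "dim_vec (data_mean D S) = D"
  by (simp add: data_mean_def mean_vec_def)

lemma cov_mat_carrier [simp]: "cov_mat D p \<in> carrier_mat D D"
  by (simp add: cov_mat_def)

lemma transpose_cov_mat: "transpose_mat (cov_mat D p) = cov_mat D p"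
  by (rule eq_matI) (auto simp: cov_mat_def mult.commute)

context
  fixes D :: nat and S :: "real vec set"
  assumes S: "finite S" "S \<noteq> {}" "S \<subseteq> carrier_vec D"
begin

lemma data_mean_index:
  "i < D \<Longrightarrow> data_mean D S $ i = (\<Sum>x\<in>S. x $ i) / card S"
  using S by (simp add: data_mean_def mean_vec_def integral_pmf_of_set)

text \<open>The parallel axis identity, proved coordinate by coordinate: the cross term vanishes
  because deviations from the mean sum to zero.\<close>

lemma sum_dist_power2:
  assumes "c \<in> carrier_vec D"
  shows "(\<Sum>x\<in>S. (vnorm (x - c))\<^sup>2) = scatter D S + card S * (vnorm (data_mean D S - c))\<^sup>2"
proof -
  let ?m = "data_mean D S"
  have coord: "(\<Sum>x\<in>S. (x $ i - c $ i)\<^sup>2)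
      = (\<Sum>x\<in>S. (x $ i - ?m $ i)\<^sup>2) + card S * (?m $ i - c $ i)\<^sup>2" if "i < D" for i
  proof -
    have m: "(\<Sum>x\<in>S. x $ i) = card S * ?m $ i"
      using S that by (simp add: data_mean_index)
    have "(\<Sum>x\<in>S. (x $ i - c $ i)\<^sup>2)
        = (\<Sum>x\<in>S. (x $ i - ?m $ i)\<^sup>2 + 2 * (?m $ i - c $ i) * x $ i
            + ((c $ i)\<^sup>2 - (?m $ i)\<^sup>2))"
      by (intro sum.cong) (auto simp: power2_eq_square algebra_simps)
    also have "\<dots> = (\<Sum>x\<in>S. (x $ i - ?m $ i)\<^sup>2) + 2 * (?m $ i - c $ i) * (card S * ?m $ i)
        + card S * ((c $ i)\<^sup>2 - (?m $ i)\<^sup>2)"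
      by (simp add: sum.distrib m flip: sum_distrib_left)
    also have "\<dots> = (\<Sum>x\<in>S. (x $ i - ?m $ i)\<^sup>2) + card S * (?m $ i - c $ i)\<^sup>2"
      by (simp add: power2_eq_square algebra_simps)
    finally show ?thesis .
  qed
  have "(\<Sum>x\<in>S. (vnorm (x - c))\<^sup>2) = (\<Sum>x\<in>S. \<Sum>i<D. (x $ i - c $ i)\<^sup>2)"
    using S assms by (intro sum.cong vnorm_diff_power2) auto
  also have "\<dots> = (\<Sum>i<D. \<Sum>x\<in>S. (x $ i - c $ i)\<^sup>2)"
    by (rule sum.swap)
  also have "\<dots> = (\<Sum>i<D. \<Sum>x\<in>S. (x $ i - ?m $ i)\<^sup>2) + card S * (\<Sum>i<D. (?m $ i - c $ i)\<^sup>2)"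
    by (simp add: coord sum.distrib sum_distrib_left)
  also have "(\<Sum>i<D. \<Sum>x\<in>S. (x $ i - ?m $ i)\<^sup>2) = (\<Sum>x\<in>S. \<Sum>i<D. (x $ i - ?m $ i)\<^sup>2)"
    by (rule sum.swap)
  also have "\<dots> = scatter D S"
    unfolding scatter_def using S by (intro sum.cong vnorm_diff_power2[symmetric]) auto
  also have "(\<Sum>i<D. (?m $ i - c $ i)\<^sup>2) = (vnorm (?m - c))\<^sup>2"
    using assms by (intro vnorm_diff_power2[symmetric]) auto
  finally show ?thesis .
qed

text \<open>The mean is the best centre, so any convenient choice of centres bounds the cost of a
  split from above.\<close>

lemma scatter_le_sum_dist_power2:
  "c \<in> carrier_vec D \<Longrightarrow> scatter D S \<le> (\<Sum>x\<in>S. (vnorm (x - c))\<^sup>2)"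
  by (simp add: sum_dist_power2)

text \<open>Apply the parallel axis identity with each data point as centre and sum the
  results.\<close>

lemma sum_pairwise_dist_power2:
  "(\<Sum>(x, x')\<in>S \<times> S. (vnorm (x - x'))\<^sup>2) = 2 * card S * scatter D S"
proof -
  have "(\<Sum>(x, x')\<in>S \<times> S. (vnorm (x - x'))\<^sup>2) = (\<Sum>x'\<in>S. \<Sum>x\<in>S. (vnorm (x - x'))\<^sup>2)"
    unfolding sum.cartesian_product[symmetric] by (rule sum.swap)
  also have "\<dots> = (\<Sum>x'\<in>S. scatter D S + card S * (vnorm (x' - data_mean D S))\<^sup>2)"
  proof (rule sum.cong)
    fix x' assume "x' \<in> S"
    then have x': "x' \<in> carrier_vec D" using S by auto
    have "(vnorm (data_mean D S - x'))\<^sup>2 = (vnorm (x' - data_mean D S))\<^sup>2"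
      using x' by (simp add: vnorm_diff_power2[where n = D] power2_commute)
    then show "(\<Sum>x\<in>S. (vnorm (x - x'))\<^sup>2) = scatter D S + card S * (vnorm (x' - data_mean D S))\<^sup>2"
      using sum_dist_power2[OF x'] by simp
  qed simp
  also have "\<dots> = 2 * card S * scatter D S"
    by (simp add: sum.distrib scatter_def flip: sum_distrib_left)
  finally show ?thesis .
qed

text \<open>With centre \<open>x\<close>, the parallel axis identity bounds the squared distance
  from \<open>x\<close> to the mean by the average squared distance from \<open>x\<close> to the
  data.\<close>

lemma dist_mean_le:
  assumes "\<And>x x'. x \<in> S \<Longrightarrow> x' \<in> S \<Longrightarrow> vnorm (x - x') \<le> M" and x: "x \<in> S"
  shows "(vnorm (x - data_mean D S))\<^sup>2 \<le> M\<^sup>2"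
proof -
  have xc: "x \<in> carrier_vec D" using x S by auto
  have "(\<Sum>y\<in>S. (vnorm (y - x))\<^sup>2) \<le> (\<Sum>y\<in>S. M\<^sup>2)"
    using assms by (intro sum_mono power_mono) (auto simp: vnorm_def scalar_prod_def intro!: sum_nonneg)
  moreover have "scatter D S \<ge> 0"
    by (simp add: scatter_def sum_nonneg)
  ultimately have "card S * (vnorm (data_mean D S - x))\<^sup>2 \<le> card S * M\<^sup>2"
    unfolding sum_dist_power2[OF xc] by simp
  moreover have "(vnorm (data_mean D S - x))\<^sup>2 = (vnorm (x - data_mean D S))\<^sup>2"
    using xc by (simp add: vnorm_diff_power2[where n = D] power2_commute)
  ultimately show ?thesis
    using S by (simp add: card_gt_0_iff)
qed

lemma sum_scalar_prod_centred:
  assumes "u \<in> carrier_vec D"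
  shows "(\<Sum>x\<in>S. u \<bullet> (x - data_mean D S)) = 0"
proof -
  have "(\<Sum>x\<in>S. u \<bullet> (x - data_mean D S)) = (\<Sum>x\<in>S. \<Sum>i<D. u $ i * (x $ i - data_mean D S $ i))"
    using S by (intro sum.cong) (auto simp: scalar_prod_def atLeast0LessThan)
  also have "\<dots> = (\<Sum>i<D. \<Sum>x\<in>S. u $ i * (x $ i - data_mean D S $ i))"
    by (rule sum.swap)
  also have "\<dots> = (\<Sum>i<D. u $ i * ((\<Sum>x\<in>S. x $ i) - card S * data_mean D S $ i))"
    by (simp add: sum_subtractf flip: sum_distrib_left)
  finally show ?thesis
    using S by (simp add: data_mean_index)
qed

text \<open>Links the spectrum to the data: at a unit eigenvector the left side is the eigenvalue,
  the right side the variance in that direction.\<close>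

lemma cov_mat_quadratic_form:
  assumes v: "v \<in> carrier_vec D"
  shows "v \<bullet> (cov_mat D (pmf_of_set S) *\<^sub>v v) = (\<Sum>x\<in>S. (v \<bullet> (x - data_mean D S))\<^sup>2) / card S"
proof -
  let ?y = "\<lambda>x i. x $ i - data_mean D S $ i"
  have "v \<bullet> (cov_mat D (pmf_of_set S) *\<^sub>v v)
      = (\<Sum>i<D. \<Sum>j<D. \<Sum>x\<in>S. (v $ i * ?y x i) * (v $ j * ?y x j) / card S)"
    using v S
    by (simp add: scalar_prod_def cov_mat_def atLeast0LessThan integral_pmf_of_set
        sum_distrib_left sum_divide_distrib flip: data_mean_def)
      (simp add: sum_distrib_left sum_distrib_right sum_divide_distrib mult_ac)
  also have "\<dots> = (\<Sum>x\<in>S. \<Sum>i<D. \<Sum>j<D. (v $ i * ?y x i) * (v $ j * ?y x j) / card S)"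
    by (subst (2) sum.swap, subst sum.swap, rule refl)
  also have "\<dots> = (\<Sum>x\<in>S. (\<Sum>i<D. v $ i * ?y x i)\<^sup>2) / card S"
    by (simp add: power2_eq_square sum_product sum_divide_distrib)
  also have "(\<Sum>x\<in>S. (\<Sum>i<D. v $ i * ?y x i)\<^sup>2) = (\<Sum>x\<in>S. (v \<bullet> (x - data_mean D S))\<^sup>2)"
    using S by (intro sum.cong) (auto simp: scalar_prod_def atLeast0LessThan)
  finally show ?thesis .
qed

end

text \<open>Compare with the split by the sign of the projection onto \<open>u\<close>, using two
  centres placed symmetrically about the mean. The number \<open>t\<close> is only a lower bound for
  the mean absolute deviation, so estimates can be inserted directly.\<close>

lemma two_means_gain:
  assumes S: "finite S" "S \<noteq> {}" "S \<subseteq> carrier_vec D"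
    and opt: "\<And>S\<^sub>1 S\<^sub>2. bisection S S\<^sub>1 S\<^sub>2 \<Longrightarrow> K \<le> two_means_cost D S\<^sub>1 S\<^sub>2"
    and u: "u \<in> carrier_vec D"
    and t: "0 < t" "t \<le> (\<Sum>x\<in>S. \<bar>u \<bullet> (x - data_mean D S)\<bar>) / card S"
  shows "K + card S * (t\<^sup>2 / (u \<bullet> u)) \<le> scatter D S"
proof -
  let ?m = "data_mean D S"
  define P where "P = {x \<in> S. 0 < u \<bullet> (x - ?m)}"
  \<comment> \<open>The minimizer of \<open>b\<^sup>2 * (u \<bullet> u) - 2 * b * t\<close>, the
    change in cost per point when the mean absolute deviation is \<open>t\<close>.\<close>
  define b where "b = t / (u \<bullet> u)"
  have card: "0 < card S" using S by (simp add: card_gt_0_iff)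
  have abs_sum: "card S * t \<le> (\<Sum>x\<in>S. \<bar>u \<bullet> (x - ?m)\<bar>)"
    using t card by (simp add: field_simps)
  then have abs_pos: "0 < (\<Sum>x\<in>S. \<bar>u \<bullet> (x - ?m)\<bar>)"
    using t card by (meson less_le_trans mult_pos_pos of_nat_0_less_iff)
  have zero: "(\<Sum>x\<in>S. u \<bullet> (x - ?m)) = 0"
    using sum_scalar_prod_centred[OF S u] .
  \<comment> \<open>The projections sum to zero; if they all had one sign, their absolute values
    would sum to zero too, against \<open>0 < t\<close>. The same argument serves for the
    complement.\<close>
  have "P \<noteq> {}"
  proof
    assume "P = {}"
    then have "(\<Sum>x\<in>S. \<bar>u \<bullet> (x - ?m)\<bar>) = (\<Sum>x\<in>S. - (u \<bullet> (x - ?m)))"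
      by (intro sum.cong) (force simp: P_def)+
    with abs_pos zero show False by (simp add: sum_negf)
  qed
  moreover have "S - P \<noteq> {}"
  proof
    assume "S - P = {}"
    then have "(\<Sum>x\<in>S. \<bar>u \<bullet> (x - ?m)\<bar>) = (\<Sum>x\<in>S. u \<bullet> (x - ?m))"
      by (intro sum.cong) (force simp: P_def)+
    with abs_pos zero show False by simp
  qed
  ultimately have "bisection S P (S - P)"
    by (auto simp: bisection_def P_def)
  then have "K \<le> scatter D P + scatter D (S - P)"
    using opt by (simp add: two_means_cost_scatter)
  also have "\<dots> \<le> (\<Sum>x\<in>P. (vnorm (x - (?m + b \<cdot>\<^sub>v u)))\<^sup>2)
      + (\<Sum>x\<in>S - P. (vnorm (x - (?m + (- b) \<cdot>\<^sub>v u)))\<^sup>2)"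
    using S u \<open>P \<noteq> {}\<close> \<open>S - P \<noteq> {}\<close>
    by (intro add_mono scatter_le_sum_dist_power2) (auto simp: P_def)
  also have "(\<Sum>x\<in>P. (vnorm (x - (?m + b \<cdot>\<^sub>v u)))\<^sup>2)
      = (\<Sum>x\<in>P. (vnorm (x - ?m))\<^sup>2 - 2 * b * \<bar>u \<bullet> (x - ?m)\<bar> + b\<^sup>2 * (u \<bullet> u))"
    using S u by (intro sum.cong refl, subst vnorm_diff_shift[where n = D]) (auto simp: P_def)
  also have "(\<Sum>x\<in>S - P. (vnorm (x - (?m + (- b) \<cdot>\<^sub>v u)))\<^sup>2)
      = (\<Sum>x\<in>S - P. (vnorm (x - ?m))\<^sup>2 - 2 * b * \<bar>u \<bullet> (x - ?m)\<bar> + b\<^sup>2 * (u \<bullet> u))"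
    using S u by (intro sum.cong refl, subst vnorm_diff_shift[where n = D]) (auto simp: P_def)
  also have "(\<Sum>x\<in>P. (vnorm (x - ?m))\<^sup>2 - 2 * b * \<bar>u \<bullet> (x - ?m)\<bar> + b\<^sup>2 * (u \<bullet> u))
      + (\<Sum>x\<in>S - P. (vnorm (x - ?m))\<^sup>2 - 2 * b * \<bar>u \<bullet> (x - ?m)\<bar> + b\<^sup>2 * (u \<bullet> u))
      = (\<Sum>x\<in>S. (vnorm (x - ?m))\<^sup>2 - 2 * b * \<bar>u \<bullet> (x - ?m)\<bar> + b\<^sup>2 * (u \<bullet> u))"
    using S by (subst add.commute, intro sum.subset_diff[symmetric]) (auto simp: P_def)
  also have "\<dots> = scatter D S - 2 * b * (\<Sum>x\<in>S. \<bar>u \<bullet> (x - ?m)\<bar>) + card S * (b\<^sup>2 * (u \<bullet> u))"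
    by (simp add: sum.distrib sum_subtractf scatter_def flip: sum_distrib_left)
  also have "\<dots> \<le> scatter D S - 2 * b * (card S * t) + card S * (b\<^sup>2 * (u \<bullet> u))"
  proof -
    have "0 \<le> b"
      using t by (simp add: b_def scalar_prod_def sum_nonneg)
    then show ?thesis using abs_sum by (simp add: mult_left_mono)
  qed
  \<comment> \<open>Should \<open>u \<bullet> u\<close> be 0, both quotients by it are 0 by
    convention and the equation still holds.\<close>
  also have "\<dots> = scatter D S - card S * (t\<^sup>2 / (u \<bullet> u))"
    by (simp add: b_def power2_eq_square divide_simps)
  finally show ?thesis by simp
qed

section \<open>Squared average diameters as costs per data point\<close>

lemma power2_avg_diam:
  assumes "finite (A \<inter> X)" "A \<inter> X \<noteq> {}" "A \<inter> X \<subseteq> carrier_vec D"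
  shows "(avg_diam X A)\<^sup>2 = 2 * scatter D (A \<inter> X) / card (A \<inter> X)"
proof -
  have "0 \<le> scatter D (A \<inter> X)"
    by (simp add: scatter_def sum_nonneg)
  then show ?thesis
    unfolding avg_diam_def sum_pairwise_dist_power2[OF assms]
    by (simp add: power_mult_distrib power_divide power2_eq_square)
qed

text \<open>The weight of each cell cancels the cell size in its squared average diameter, and the
  size of \<open>X\<close> cancels between numerator and denominator.\<close>

lemma power2_avg_diam_coll:
  assumes X: "finite X" "X \<subseteq> carrier_vec D" and split: "two_means_split D X A A\<^sub>1 A\<^sub>2"
  shows "(avg_diam_coll X {A\<^sub>1, A\<^sub>2})\<^sup>2
    = 2 * two_means_cost D (A\<^sub>1 \<inter> X) (A\<^sub>2 \<inter> X) / card (A \<inter> X)"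
proof -
  have A: "A\<^sub>1 \<inter> A\<^sub>2 = {}" "A\<^sub>1 \<inter> X \<noteq> {}" "A\<^sub>2 \<inter> X \<noteq> {}" "A \<inter> X = (A\<^sub>1 \<inter> X) \<union> (A\<^sub>2 \<inter> X)"
    using split by (auto simp: two_means_split_def bisection_def)
  \<comment> \<open>Distinctness ensures that the sum over the set
    \<open>{A\<^sub>1, A\<^sub>2}\<close> really has two terms.\<close>
  have ne: "A\<^sub>1 \<noteq> A\<^sub>2" "X \<noteq> {}" using A by auto
  have card: "card (A \<inter> X) = card (A\<^sub>1 \<inter> X) + card (A\<^sub>2 \<inter> X)"
    unfolding A(4) using X A by (intro card_Un_disjoint) auto
  have pr: "measure_pmf.prob (pmf_of_set X) B = card (B \<inter> X) / card X" for B
    using X ne by (simp add: measure_pmf_of_set Int_commute)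
  have cell: "card (B \<inter> X) / card X * (avg_diam X B)\<^sup>2 = 2 * scatter D (B \<inter> X) / card X"
    if "B \<inter> X \<noteq> {}" for B
  proof -
    have "card (B \<inter> X) \<noteq> 0" using that X by simp
    then show ?thesis
      using that X by (subst power2_avg_diam[where D = D]) auto
  qed
  have "(avg_diam_coll X {A\<^sub>1, A\<^sub>2})\<^sup>2
      = (2 * scatter D (A\<^sub>1 \<inter> X) / card X + 2 * scatter D (A\<^sub>2 \<inter> X) / card X)
        / (card (A\<^sub>1 \<inter> X) / card X + card (A\<^sub>2 \<inter> X) / card X)"
  proof -
    have "(avg_diam_coll X {A\<^sub>1, A\<^sub>2})\<^sup>2
        = (card (A\<^sub>1 \<inter> X) / card X * (avg_diam X A\<^sub>1)\<^sup>2 + card (A\<^sub>2 \<inter> X) / card X * (avg_diam X A\<^sub>2)\<^sup>2)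
          / (card (A\<^sub>1 \<inter> X) / card X + card (A\<^sub>2 \<inter> X) / card X)"
      unfolding avg_diam_coll_def using ne by (simp add: pr)
    then show ?thesis by (simp only: cell[OF A(2)] cell[OF A(3)])
  qed
  also have "\<dots> = 2 * (scatter D (A\<^sub>1 \<inter> X) + scatter D (A\<^sub>2 \<inter> X)) / card (A \<inter> X)"
  proof -
    have "card X \<noteq> 0" using X ne by simp
    then show ?thesis
      unfolding card by (simp add: add_divide_distrib[symmetric] distrib_left)
  qed
  finally show ?thesis by (simp add: two_means_cost_scatter)
qed

subsection \<open>Directions with large mean absolute deviation\<close>

text \<open>The sets \<open>T\<close> encode sign patterns, so the sums over \<open>Pow I\<close>
  are \<open>2 ^ card I\<close> times expectations over random signs. Adding an index
  \<open>a\<close> turns each signed sum \<open>w\<close> into the pair \<open>w - z a\<close>,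
  \<open>w + z a\<close>, whose odd cross terms cancel.\<close>

lemma rademacher_moments:
  fixes z :: "'a \<Rightarrow> real"
  assumes "finite I"
  shows "(\<Sum>T\<in>Pow I. (\<Sum>i\<in>I. (if i \<in> T then 1 else - 1) * z i)\<^sup>2) = 2 ^ card I * (\<Sum>i\<in>I. (z i)\<^sup>2)"
    and "(\<Sum>T\<in>Pow I. (\<Sum>i\<in>I. (if i \<in> T then 1 else - 1) * z i) ^ 4)
      \<le> 3 * 2 ^ card I * (\<Sum>i\<in>I. (z i)\<^sup>2)\<^sup>2"
proof -
  define W where "W I T = (\<Sum>i\<in>I. (if i \<in> T then 1 else - 1) * z i)" for I T
  have split: "(\<Sum>T\<in>Pow (insert a I). f (W (insert a I) T))
      = (\<Sum>T\<in>Pow I. f (W I T - z a) + f (W I T + z a))"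
    if "finite I" "a \<notin> I" for I a and f :: "real \<Rightarrow> real"
  proof -
    have W: "W (insert a I) T = W I T - z a" "W (insert a I) (insert a T) = W I T + z a"
      if "T \<subseteq> I" for T
    proof -
      have "W I (insert a T) = W I T"
        unfolding W_def using \<open>a \<notin> I\<close> by (intro sum.cong) auto
      then show "W (insert a I) T = W I T - z a" "W (insert a I) (insert a T) = W I T + z a"
        using that \<open>finite I\<close> \<open>a \<notin> I\<close> by (auto simp: W_def)
    qed
    have "(\<Sum>T\<in>Pow (insert a I). f (W (insert a I) T))
        = (\<Sum>T\<in>Pow I. f (W (insert a I) T)) + (\<Sum>T\<in>insert a ` Pow I. f (W (insert a I) T))"
      unfolding Pow_insert using that by (intro sum.union_disjoint) auto
    also have "(\<Sum>T\<in>insert a ` Pow I. f (W (insert a I) T)) = (\<Sum>T\<in>Pow I. f (W (insert a I) (insert a T)))"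
      using that by (intro sum.reindex[unfolded o_def]) (auto simp: inj_on_def)
    finally show ?thesis
      by (simp add: W sum.distrib)
  qed
  have "(\<Sum>T\<in>Pow I. (W I T)\<^sup>2) = 2 ^ card I * (\<Sum>i\<in>I. (z i)\<^sup>2)
      \<and> (\<Sum>T\<in>Pow I. W I T ^ 4) \<le> 3 * 2 ^ card I * (\<Sum>i\<in>I. (z i)\<^sup>2)\<^sup>2"
    using assms
  proof (induction I rule: finite_induct)
    case empty
    show ?case by (simp add: W_def)
  next
    case (insert a I)
    let ?s = "\<Sum>i\<in>I. (z i)\<^sup>2" and ?N = "2 ^ card I :: real"
    note IH = insert.IH
    have N: "(\<Sum>T\<in>Pow I. c) = ?N * c" for c :: real
      using insert.hyps by (simp add: card_Pow)
    have s: "(\<Sum>i\<in>insert a I. (z i)\<^sup>2) = (z a)\<^sup>2 + ?s" "2 ^ card (insert a I) = 2 * ?N"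
      using insert.hyps by auto
    have "(\<Sum>T\<in>Pow (insert a I). (W (insert a I) T)\<^sup>2)
        = (\<Sum>T\<in>Pow I. 2 * (W I T)\<^sup>2 + 2 * (z a)\<^sup>2)"
      using insert.hyps by (subst split) (auto intro!: sum.cong simp: power2_eq_square algebra_simps)
    also have "\<dots> = 2 * (\<Sum>T\<in>Pow I. (W I T)\<^sup>2) + ?N * (2 * (z a)\<^sup>2)"
      by (simp only: sum.distrib N sum_distrib_left[symmetric])
    finally have 2: "(\<Sum>T\<in>Pow (insert a I). (W (insert a I) T)\<^sup>2) = 2 * ?N * ((z a)\<^sup>2 + ?s)"
      using IH by (simp add: algebra_simps)
    have "(\<Sum>T\<in>Pow (insert a I). (W (insert a I) T) ^ 4)
        = (\<Sum>T\<in>Pow I. 2 * W I T ^ 4 + 12 * (z a)\<^sup>2 * (W I T)\<^sup>2 + 2 * z a ^ 4)"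
      using insert.hyps
      by (subst split[where f = "\<lambda>w. w ^ 4"])
        (auto intro!: sum.cong simp: power2_eq_square power4_eq_xxxx algebra_simps)
    also have "\<dots> = 2 * (\<Sum>T\<in>Pow I. W I T ^ 4) + 12 * (z a)\<^sup>2 * (\<Sum>T\<in>Pow I. (W I T)\<^sup>2) + ?N * (2 * z a ^ 4)"
      by (simp only: sum.distrib N sum_distrib_left[symmetric])
    \<comment> \<open>The coefficient of \<open>z a ^ 4\<close> is raised from 2 to 6 so that the
      bound becomes a perfect square.\<close>
    also have "\<dots> \<le> 2 * (3 * ?N * ?s\<^sup>2) + 12 * (z a)\<^sup>2 * (?N * ?s) + ?N * (6 * z a ^ 4)"
      using IH by (intro add_mono mult_left_mono) auto
    also have "\<dots> = 3 * (2 * ?N) * ((z a)\<^sup>2 + ?s)\<^sup>2"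
      by (simp add: power2_eq_square power4_eq_xxxx algebra_simps)
    finally show ?case
      unfolding s using 2 by simp
  qed
  then show "(\<Sum>T\<in>Pow I. (\<Sum>i\<in>I. (if i \<in> T then 1 else - 1) * z i)\<^sup>2) = 2 ^ card I * (\<Sum>i\<in>I. (z i)\<^sup>2)"
    "(\<Sum>T\<in>Pow I. (\<Sum>i\<in>I. (if i \<in> T then 1 else - 1) * z i) ^ 4)
      \<le> 3 * 2 ^ card I * (\<Sum>i\<in>I. (z i)\<^sup>2)\<^sup>2"
    by (auto simp: W_def)
qed

text \<open>
  This lower bound is linear in $w^2$ and $w^4$, so it can be averaged over data and signs without
  Hoelder's inequality.
\<close>
lemma abs_ge_quartic:
  fixes w t :: real
  assumes "0 \<le> t"
  shows "t * w\<^sup>2 - t ^ 3 * w ^ 4 \<le> \<bar>w\<bar>"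
proof (cases "t * \<bar>w\<bar> \<le> 1")
  \<comment> \<open>Here the quadratic term alone is at most \<open>\<bar>w\<bar>\<close>; in the
    other case the quartic term outweighs it and the left side is not positive.\<close>
  case True
  then have "t * \<bar>w\<bar> * \<bar>w\<bar> \<le> \<bar>w\<bar>"
    using mult_right_mono[of "t * \<bar>w\<bar>" 1 "\<bar>w\<bar>"] by simp
  then have "t * w\<^sup>2 \<le> \<bar>w\<bar>"
    by (simp add: power2_eq_square abs_mult_self_eq mult.assoc)
  moreover have "0 \<le> t ^ 3 * w ^ 4" using assms by simp
  ultimately show ?thesis by linarith
next
  case False
  then have "1 \<le> (t * \<bar>w\<bar>)\<^sup>2" by (simp add: one_le_power)
  then have "t * w\<^sup>2 * 1 \<le> t * w\<^sup>2 * (t * \<bar>w\<bar>)\<^sup>2"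
    using assms by (intro mult_left_mono) auto
  also have "\<dots> = t ^ 3 * w ^ 4"
    by (simp add: power_mult_distrib power2_eq_square power3_eq_cube power4_eq_xxxx mult_ac)
  finally show ?thesis by simp
qed

text \<open>A probabilistic argument: the quartic bound is averaged over all signs for each
  \<open>x\<close>, where \<open>R\<close> turns the fourth moment into a multiple of the second.
  After summation over \<open>S\<close> some sign pattern reaches the average.\<close>

lemma exists_signs_abs_sum_ge:
  fixes z :: "'b \<Rightarrow> 'a \<Rightarrow> real"
  assumes "finite I" and R: "\<And>x. x \<in> S \<Longrightarrow> (\<Sum>i\<in>I. (z x i)\<^sup>2) \<le> R" and t: "0 \<le> t"
  shows "\<exists>T. (t - 3 * t ^ 3 * R) * (\<Sum>x\<in>S. \<Sum>i\<in>I. (z x i)\<^sup>2)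
    \<le> (\<Sum>x\<in>S. \<bar>\<Sum>i\<in>I. (if i \<in> T then 1 else - 1) * z x i\<bar>)"
proof -
  let ?W = "\<lambda>T x. \<Sum>i\<in>I. (if i \<in> T then 1 else - 1) * z x i"
  let ?N = "2 ^ card I :: real"
  have each: "?N * ((t - 3 * t ^ 3 * R) * (\<Sum>i\<in>I. (z x i)\<^sup>2)) \<le> (\<Sum>T\<in>Pow I. \<bar>?W T x\<bar>)"
    if x: "x \<in> S" for x
  proof -
    let ?s = "\<Sum>i\<in>I. (z x i)\<^sup>2"
    have s: "?s\<^sup>2 \<le> R * ?s"
      using R[OF x] by (simp add: power2_eq_square mult_right_mono sum_nonneg)
    have "?N * ((t - 3 * t ^ 3 * R) * ?s) = t * (?N * ?s) - t ^ 3 * (3 * ?N * (R * ?s))"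
      by (simp add: algebra_simps)
    also have "\<dots> \<le> t * (?N * ?s) - t ^ 3 * (3 * ?N * ?s\<^sup>2)"
      using s t by (intro diff_left_mono mult_left_mono) auto
    also have "\<dots> \<le> t * (\<Sum>T\<in>Pow I. (?W T x)\<^sup>2) - t ^ 3 * (\<Sum>T\<in>Pow I. (?W T x) ^ 4)"
      using rademacher_moments[OF assms(1), of "z x"] t
      by (intro diff_mono mult_left_mono) auto
    also have "\<dots> = (\<Sum>T\<in>Pow I. t * (?W T x)\<^sup>2 - t ^ 3 * (?W T x) ^ 4)"
      by (simp only: sum_subtractf sum_distrib_left)
    also have "\<dots> \<le> (\<Sum>T\<in>Pow I. \<bar>?W T x\<bar>)"
      using t by (intro sum_mono abs_ge_quartic)
    finally show ?thesis .
  qed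
  let ?L = "(t - 3 * t ^ 3 * R) * (\<Sum>x\<in>S. \<Sum>i\<in>I. (z x i)\<^sup>2)"
  have "(\<Sum>T\<in>Pow I. ?L) = (\<Sum>x\<in>S. ?N * ((t - 3 * t ^ 3 * R) * (\<Sum>i\<in>I. (z x i)\<^sup>2)))"
    using assms(1) by (simp add: card_Pow sum_distrib_left)
  also have "\<dots> \<le> (\<Sum>x\<in>S. \<Sum>T\<in>Pow I. \<bar>?W T x\<bar>)"
    by (intro sum_mono each)
  also have "\<dots> = (\<Sum>T\<in>Pow I. \<Sum>x\<in>S. \<bar>?W T x\<bar>)"
    by (rule sum.swap)
  finally have le: "(\<Sum>T\<in>Pow I. ?L) \<le> (\<Sum>T\<in>Pow I. \<Sum>x\<in>S. \<bar>?W T x\<bar>)" .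
  show ?thesis
  proof (rule ccontr)
    assume "\<not> ?thesis"
    then have "(\<Sum>T\<in>Pow I. \<Sum>x\<in>S. \<bar>?W T x\<bar>) < (\<Sum>T\<in>Pow I. ?L)"
      using assms(1) by (intro sum_strict_mono) (auto simp: not_le)
    with le show False by simp
  qed
qed

text \<open>Since \<open>\<bar>y x\<bar>\<close> is at most \<open>sqrt R\<close>, each square is at
  most \<open>sqrt R\<close> times the absolute value.\<close>

lemma mean_abs_ge_second_moment:
  fixes y :: "'a \<Rightarrow> real"
  assumes "0 < R" "\<And>x. x \<in> S \<Longrightarrow> (y x)\<^sup>2 \<le> R"
  shows "(\<Sum>x\<in>S. (y x)\<^sup>2) / sqrt R \<le> (\<Sum>x\<in>S. \<bar>y x\<bar>)"
  unfolding sum_divide_distrib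
proof (rule sum_mono)
  fix x assume "x \<in> S"
  then have "\<bar>y x\<bar> \<le> sqrt R"
    using assms(2) real_le_rsqrt by fastforce
  then have "\<bar>y x\<bar> * \<bar>y x\<bar> \<le> \<bar>y x\<bar> * sqrt R"
    by (intro mult_left_mono) auto
  then show "(y x)\<^sup>2 / sqrt R \<le> \<bar>y x\<bar>"
    using assms(1) by (simp add: divide_simps power2_eq_square)
qed

text \<open>Take the signed sum of the vectors \<open>b i\<close>. Orthonormality makes its squared
  length \<open>d\<close> for every choice of signs, and this is the source of the factor
  \<open>1 / d\<close> in the gain.\<close>

lemma exists_direction_mean_abs_ge:
  fixes b :: "nat \<Rightarrow> real vec"
  assumes b: "\<And>i. i < d \<Longrightarrow> b i \<in> carrier_vec D"
    and orth: "\<And>i j. i < d \<Longrightarrow> j < d \<Longrightarrow> b i \<bullet> b j = (if i = j then 1 else 0)"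
    and y: "\<And>x. x \<in> S \<Longrightarrow> y x \<in> carrier_vec D"
    and R: "\<And>x. x \<in> S \<Longrightarrow> (\<Sum>i<d. (b i \<bullet> y x)\<^sup>2) \<le> R" and t: "0 \<le> t"
  shows "\<exists>u\<in>carrier_vec D. u \<bullet> u = real d \<and>
    (t - 3 * t ^ 3 * R) * (\<Sum>x\<in>S. \<Sum>i<d. (b i \<bullet> y x)\<^sup>2) \<le> (\<Sum>x\<in>S. \<bar>u \<bullet> y x\<bar>)"
proof -
  obtain T where T: "(t - 3 * t ^ 3 * R) * (\<Sum>x\<in>S. \<Sum>i<d. (b i \<bullet> y x)\<^sup>2)
      \<le> (\<Sum>x\<in>S. \<bar>\<Sum>i<d. (if i \<in> T then 1 else - 1) * (b i \<bullet> y x)\<bar>)"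
    using exists_signs_abs_sum_ge[of "{..<d}" S "\<lambda>x i. b i \<bullet> y x" R t] R t by auto
  define s :: "nat \<Rightarrow> real" where "s i = (if i \<in> T then 1 else - 1)" for i
  define u where "u = vec D (\<lambda>j. \<Sum>i<d. s i * b i $ j)"
  have u: "u \<in> carrier_vec D" by (simp add: u_def)
  have prod: "u \<bullet> w = (\<Sum>i<d. s i * (b i \<bullet> w))" if "w \<in> carrier_vec D" for w
  proof -
    have "u \<bullet> w = (\<Sum>j<D. \<Sum>i<d. s i * (b i $ j * w $ j))"
      using that by (simp add: u_def scalar_prod_def atLeast0LessThan sum_distrib_right mult.assoc)
    also have "\<dots> = (\<Sum>i<d. \<Sum>j<D. s i * (b i $ j * w $ j))"
      by (rule sum.swap)
    also have "\<dots> = (\<Sum>i<d. s i * (b i \<bullet> w))"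
      using that by (simp add: scalar_prod_def atLeast0LessThan sum_distrib_left)
    finally show ?thesis .
  qed
  have bu: "b i \<bullet> u = s i" if i: "i < d" for i
  proof -
    have "b i \<bullet> u = u \<bullet> b i" using b[OF i] u by (rule comm_scalar_prod)
    also have "\<dots> = (\<Sum>j<d. if j = i then s i else 0)"
      unfolding prod[OF b[OF i]] using i by (intro sum.cong) (auto simp: orth)
    finally show ?thesis using i by simp
  qed
  have "u \<bullet> u = (\<Sum>i<d. s i * s i)"
    unfolding prod[OF u] by (simp add: bu)
  also have "\<dots> = real d"
    by (simp add: s_def if_distrib cong: if_cong)
  finally have "u \<bullet> u = real d" .
  moreover have "(t - 3 * t ^ 3 * R) * (\<Sum>x\<in>S. \<Sum>i<d. (b i \<bullet> y x)\<^sup>2) \<le> (\<Sum>x\<in>S. \<bar>u \<bullet> y x\<bar>)"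
    using T prod[OF y] by (simp add: s_def)
  ultimately show ?thesis using u by blast
qed

subsection \<open>The decrease of the average diameter\<close>

text \<open>Here \<open>c\<^sub>1\<close> is 1/2: the first \<open>d\<close> eigenvalues carry at
  least half of the variance. The bound with \<open>192 * c\<close> serves the rates in
  \<open>d\<close> and in \<open>k\<^sup>2\<close>, the bound with \<open>2 * c\<^sub>0\<close> the
  rate in \<open>k\<close>.\<close>

lemma two_means_decrease:
  fixes c c\<^sub>0 c\<^sub>2 :: real and D d :: nat and X A :: "real vec set"
  defines "p \<equiv> pmf_of_set (A \<inter> X)"
  defines "lam \<equiv> eigvals_desc (cov_mat D p)"
  defines "k \<equiv> 1 / lam ! 0 * (\<Sum>i<d. lam ! i)"
  assumes c: "0 < c" "1 \<le> c\<^sub>0" "0 < c\<^sub>2" "c\<^sub>2 * (192 * c) < 1" "c\<^sub>2 * (2 * c\<^sub>0) < 1"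
    and X: "X \<subseteq> carrier_vec D" "finite X" "A \<subseteq> carrier_vec D"
    and diam: "0 < avg_diam X A" "(max_diam X A)\<^sup>2 \<le> c * (avg_diam X A)\<^sup>2"
    and split: "two_means_split D X A A\<^sub>1 A\<^sub>2"
    and d: "1 \<le> d" "has_cov_dim D p d (1 / 2)"
  shows "\<exists>d'. 0 < d' \<and> d' \<le> min (real d) (k\<^sup>2) \<and>
      (avg_diam_coll X {A\<^sub>1, A\<^sub>2})\<^sup>2 < (1 - c\<^sub>2 / d') * (avg_diam X A)\<^sup>2"
    and "\<lbrakk>eigenvector (cov_mat D p) v (lam ! 0);
      \<And>s. measure_pmf.expectation p (\<lambda>x. (x \<bullet> v - s)\<^sup>2)
        \<le> c\<^sub>0 * (measure_pmf.expectation p (\<lambda>x. \<bar>x \<bullet> v - s\<bar>))\<^sup>2\<rbrakk> \<Longrightarrow>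
      \<exists>d'. 0 < d' \<and> d' \<le> k \<and>
        (avg_diam_coll X {A\<^sub>1, A\<^sub>2})\<^sup>2 < (1 - c\<^sub>2 / d') * (avg_diam X A)\<^sup>2"
proof -
  define S where "S = A \<inter> X"
  define \<mu> where "\<mu> = data_mean D S"
  define V where "V = scatter D S / card S"
  define C where "C = cov_mat D p"
  have bisection: "bisection S (A\<^sub>1 \<inter> X) (A\<^sub>2 \<inter> X)"
    and opt: "\<And>S\<^sub>1 S\<^sub>2. bisection S S\<^sub>1 S\<^sub>2 \<Longrightarrow>
      two_means_cost D (A\<^sub>1 \<inter> X) (A\<^sub>2 \<inter> X) \<le> two_means_cost D S\<^sub>1 S\<^sub>2"
    using split unfolding two_means_split_def S_def by blast+
  have S: "finite S" "S \<noteq> {}" "S \<subseteq> carrier_vec D"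
    using bisection X(2,3) by (auto simp: S_def bisection_def)
  have card: "0 < card S" using S by (simp add: card_gt_0_iff)
  have \<mu>: "\<mu> \<in> carrier_vec D" by (simp add: \<mu>_def)
  have y: "x - \<mu> \<in> carrier_vec D" if "x \<in> S" for x using that S \<mu> by auto
  have avg: "(avg_diam X A)\<^sup>2 = 2 * V"
    using power2_avg_diam[of A X D] S by (simp add: S_def V_def)
  have V: "0 < V"
    using avg diam(1) zero_less_power[OF diam(1), of 2] by simp
  \<comment> \<open>Both squared diameters are twice a cost per point, so it suffices to find a
    direction whose gain per point exceeds the fraction \<open>c\<^sub>2 / d'\<close> of
    \<open>V\<close>.\<close>
  have decrease: "(avg_diam_coll X {A\<^sub>1, A\<^sub>2})\<^sup>2 < (1 - c\<^sub>2 / d') * (avg_diam X A)\<^sup>2"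
    if u: "u \<in> carrier_vec D" and t: "0 < t" "t \<le> (\<Sum>x\<in>S. \<bar>u \<bullet> (x - \<mu>)\<bar>) / card S"
      and gain: "c\<^sub>2 * V / d' < t\<^sup>2 / (u \<bullet> u)" for u t d'
  proof -
    let ?K = "two_means_cost D (A\<^sub>1 \<inter> X) (A\<^sub>2 \<inter> X)"
    have "?K + card S * (t\<^sup>2 / (u \<bullet> u)) \<le> scatter D S"
      using two_means_gain[OF S opt u t[unfolded \<mu>_def]] .
    from divide_right_mono[OF this, of "card S"] have le: "?K / card S + t\<^sup>2 / (u \<bullet> u) \<le> V"
      using card by (simp add: V_def add_divide_distrib)
    have coll: "(avg_diam_coll X {A\<^sub>1, A\<^sub>2})\<^sup>2 = 2 * (?K / card S)"
      using power2_avg_diam_coll[OF X(2,1) split] by (simp add: S_def)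
    have "2 * (?K / card S) < 2 * (V - c\<^sub>2 * V / d')"
      using add_less_le_mono[OF gain le] by simp
    also have "2 * (V - c\<^sub>2 * V / d') = (1 - c\<^sub>2 / d') * (2 * V)"
      by (simp add: algebra_simps)
    finally show ?thesis
      unfolding avg coll .
  qed

  \<comment> \<open>Eigenvalues as second moments in the eigenbasis\<close>
  have quad: "v \<bullet> (C *\<^sub>v v) = (\<Sum>x\<in>S. (v \<bullet> (x - \<mu>))\<^sup>2) / card S" if "v \<in> carrier_vec D" for v
    using cov_mat_quadratic_form[OF S that] by (simp add: C_def p_def S_def \<mu>_def)
  have C: "C \<in> carrier_mat D D" "transpose_mat C = C"
    by (simp_all add: C_def transpose_cov_mat)
  obtain b where b: "\<And>i. i < D \<Longrightarrow> b i \<in> carrier_vec D"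
    and orth: "\<And>i j. i < D \<Longrightarrow> j < D \<Longrightarrow> b i \<bullet> b j = (if i = j then 1 else 0)"
    and eig: "\<And>i. i < D \<Longrightarrow> C *\<^sub>v b i = lam ! i \<cdot>\<^sub>v b i"
    and parseval: "\<And>x. x \<in> carrier_vec D \<Longrightarrow> x \<bullet> x = (\<Sum>i<D. (b i \<bullet> x)\<^sup>2)"
    using orthonormal_eigenbasis[OF C] unfolding lam_def C_def by blast
  have lam: "lam ! i = (\<Sum>x\<in>S. (b i \<bullet> (x - \<mu>))\<^sup>2) / card S" if "i < D" for i
    using quad[OF b[OF that]] b[OF that] orth[OF that that] by (simp add: eig[OF that])
  \<comment> \<open>The trace identity, obtained from Parseval at each data point.\<close>
  have V_eq: "V = (\<Sum>i<D. lam ! i)"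
  proof -
    have "scatter D S = (\<Sum>x\<in>S. \<Sum>i<D. (b i \<bullet> (x - \<mu>))\<^sup>2)"
      unfolding scatter_def vnorm_power2 \<mu>_def[symmetric] by (intro sum.cong parseval y) auto
    also have "\<dots> = (\<Sum>i<D. \<Sum>x\<in>S. (b i \<bullet> (x - \<mu>))\<^sup>2)"
      by (rule sum.swap)
    finally show ?thesis
      by (simp add: V_def lam sum_divide_distrib)
  qed
  have dD: "d \<le> D" and Sd: "V / 2 \<le> (\<Sum>i<d. lam ! i)"
    using d(2) by (auto simp: has_cov_dim_def V_eq lam_def Let_def)
  have D: "0 < D" using d dD by simp
  have len: "length lam = D"
    using eigvals_desc_symmetric(1)[OF C] by (simp add: lam_def C_def)
  have lam_le: "lam ! i \<le> lam ! 0" if "i < D" for i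
  proof (cases "i = 0")
    case False
    with sorted_eigvals_desc[of C] that len show ?thesis
      by (auto simp: lam_def C_def sorted_wrt_iff_nth_less)
  qed simp
  have Sd_le: "(\<Sum>i<d. lam ! i) \<le> d * lam ! 0"
    using sum_bounded_above[of "{..<d}" "\<lambda>i. lam ! i" "lam ! 0"] lam_le dD by simp
  \<comment> \<open>Otherwise the first \<open>d\<close> eigenvalues could not carry half of the
    positive variance; this makes the division in \<open>k\<close> meaningful.\<close>
  have lam0: "0 < lam ! 0"
    using Sd_le Sd V by (smt (verit) half_gt_zero mult_nonneg_nonpos of_nat_0_le_iff)
  have k: "0 < k" "k \<le> d" "V \<le> 2 * lam ! 0 * k"
    using lam0 Sd Sd_le V by (auto simp: k_def field_simps)
  \<comment> \<open>The diameter hypothesis together with \<open>avg\<close> bounds the squared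
    maximum diameter by this number, hence also every squared distance to the mean.\<close>
  define R where "R = 2 * c * V"
  have R: "0 < R" using c V by (simp add: R_def)
  have bound: "(\<Sum>i<D. (b i \<bullet> (x - \<mu>))\<^sup>2) \<le> R" if x: "x \<in> S" for x
  proof -
    have "vnorm (x - x') \<le> max_diam X A" if "x \<in> S" "x' \<in> S" for x x'
      unfolding max_diam_def using that S(1) by (intro Max_ge) (force simp: S_def)+
    then have "(vnorm (x - \<mu>))\<^sup>2 \<le> (max_diam X A)\<^sup>2"
      unfolding \<mu>_def using x by (intro dist_mean_le[OF S])
    also have "\<dots> \<le> R" using diam(2) avg by (simp add: R_def)
    finally show ?thesis by (simp add: vnorm_power2 parseval[OF y[OF x]])
  qed
  have bound_d: "(\<Sum>i<e. (b i \<bullet> (x - \<mu>))\<^sup>2) \<le> R" if "x \<in> S" "e \<le> D" for x e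
    using sum_mono2[of "{..<D}" "{..<e}" "\<lambda>i. (b i \<bullet> (x - \<mu>))\<^sup>2"] bound[OF that(1)] that(2) by force

  \<comment> \<open>The rate in the dimension d\<close>
  have by_d: "(avg_diam_coll X {A\<^sub>1, A\<^sub>2})\<^sup>2 < (1 - c\<^sub>2 / real d) * (avg_diam X A)\<^sup>2"
  proof -
    \<comment> \<open>Chosen so that the quartic correction \<open>3 * t ^ 3 * R\<close> is exactly
      half of \<open>t\<close>.\<close>
    define t where "t = 1 / sqrt (6 * R)"
    have t: "0 < t" "t\<^sup>2 * (6 * R) = 1"
      using R by (auto simp: t_def power_divide)
    have "3 * t ^ 3 * R = t / 2 * (t\<^sup>2 * (6 * R))"
      by (simp add: power3_eq_cube power2_eq_square)
    then have coeff: "t - 3 * t ^ 3 * R = t / 2"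
      by (simp add: t)
    obtain u where u: "u \<in> carrier_vec D" "u \<bullet> u = real d"
      and le: "t / 2 * (\<Sum>x\<in>S. \<Sum>i<d. (b i \<bullet> (x - \<mu>))\<^sup>2) \<le> (\<Sum>x\<in>S. \<bar>u \<bullet> (x - \<mu>)\<bar>)"
      using exists_direction_mean_abs_ge[of d b D S "\<lambda>x. x - \<mu>" R t] b orth dD y bound_d t
      unfolding coeff by auto
    have "(\<Sum>x\<in>S. \<Sum>i<d. (b i \<bullet> (x - \<mu>))\<^sup>2) = card S * (\<Sum>i<d. lam ! i)"
      unfolding sum.swap[of _ "{..<d}" S] sum_distrib_left
      by (intro sum.cong) (use dD card in \<open>simp_all add: lam\<close>)
    then have le': "t / 2 * (\<Sum>i<d. lam ! i) \<le> (\<Sum>x\<in>S. \<bar>u \<bullet> (x - \<mu>)\<bar>) / card S"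
      using le card by (simp add: field_simps)
    have "t / 4 * V \<le> t / 2 * (\<Sum>i<d. lam ! i)"
      using Sd t by (simp add: field_simps)
    with le' have mean: "t / 4 * V \<le> (\<Sum>x\<in>S. \<bar>u \<bullet> (x - \<mu>)\<bar>) / card S" by linarith
    \<comment> \<open>Since \<open>t\<^sup>2 = 1 / (12 * c * V)\<close>, the constant is
      \<open>16 * 12 = 192\<close>.\<close>
    have "(t / 4 * V)\<^sup>2 = V / (192 * c)"
      using t(2) V c by (simp add: R_def field_simps power2_eq_square)
    moreover have "c\<^sub>2 * V / real d < V / (192 * c) / real d"
      using c V d(1) by (intro divide_strict_right_mono) (auto simp: field_simps)
    ultimately show ?thesis
      using t V u mean by (intro decrease[where u = u and t = "t / 4 * V"]) auto
  qed

  \<comment> \<open>The rate in the square of k from the principal direction\<close>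
  have by_k: "(avg_diam_coll X {A\<^sub>1, A\<^sub>2})\<^sup>2 < (1 - c\<^sub>2 / k\<^sup>2) * (avg_diam X A)\<^sup>2"
  proof -
    have "(b 0 \<bullet> (x - \<mu>))\<^sup>2 \<le> R" if "x \<in> S" for x
      using bound_d[OF that, of 1] D by simp
    from mean_abs_ge_second_moment[OF R this]
    have "(\<Sum>x\<in>S. (b 0 \<bullet> (x - \<mu>))\<^sup>2) / sqrt R / card S \<le> (\<Sum>x\<in>S. \<bar>b 0 \<bullet> (x - \<mu>)\<bar>) / card S"
      by (intro divide_right_mono) auto
    then have mean: "lam ! 0 / sqrt R \<le> (\<Sum>x\<in>S. \<bar>b 0 \<bullet> (x - \<mu>)\<bar>) / card S"
      using lam[OF D] by (simp add: mult.commute)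
    \<comment> \<open>The gain is \<open>(lam ! 0)\<^sup>2 / R\<close>. Replacing \<open>V\<close>
      by its bound \<open>2 * lam ! 0 * k\<close> twice shows that
      \<open>c\<^sub>2 * (8 * c) < 1\<close> is enough.\<close>
    have "c\<^sub>2 * V * R = c\<^sub>2 * (2 * c) * V\<^sup>2"
      by (simp add: R_def power2_eq_square)
    also have "\<dots> \<le> c\<^sub>2 * (2 * c) * (2 * lam ! 0 * k)\<^sup>2"
      using k(3) V c by (intro mult_left_mono power_mono) auto
    also have "\<dots> = c\<^sub>2 * (8 * c) * ((lam ! 0)\<^sup>2 * k\<^sup>2)"
      by (simp add: power2_eq_square)
    also have "\<dots> < 1 * ((lam ! 0)\<^sup>2 * k\<^sup>2)"
    proof (intro mult_strict_right_mono)
      have "0 < c\<^sub>2 * c" using c by simp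
      then show "c\<^sub>2 * (8 * c) < 1" using c(4) by linarith
    qed (use k lam0 in auto)
    finally have "c\<^sub>2 * V / k\<^sup>2 < (lam ! 0)\<^sup>2 / R"
      using k R by (simp add: field_simps)
    then show ?thesis
      using lam0 R b[OF D] orth[OF D D] mean
      by (intro decrease[where u = "b 0" and t = "lam ! 0 / sqrt R"]) (auto simp: power_divide)
  qed
  \<comment> \<open>Both rates hold with the same \<open>c\<^sub>2\<close>, so the minimum itself
    can be taken as \<open>d'\<close>.\<close>
  show "\<exists>d'. 0 < d' \<and> d' \<le> min (real d) (k\<^sup>2) \<and>
      (avg_diam_coll X {A\<^sub>1, A\<^sub>2})\<^sup>2 < (1 - c\<^sub>2 / d') * (avg_diam X A)\<^sup>2"
    by (rule exI[of _ "min (real d) (k\<^sup>2)"]) (use by_d by_k k d in \<open>auto simp: min_def\<close>)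
  assume v: "eigenvector (cov_mat D p) v (lam ! 0)"
    and moment: "\<And>s. measure_pmf.expectation p (\<lambda>x. (x \<bullet> v - s)\<^sup>2)
        \<le> c\<^sub>0 * (measure_pmf.expectation p (\<lambda>x. \<bar>x \<bullet> v - s\<bar>))\<^sup>2"
  have vc: "v \<in> carrier_vec D" and v0: "v \<noteq> 0\<^sub>v D" and Cv: "C *\<^sub>v v = lam ! 0 \<cdot>\<^sub>v v"
    using v C by (auto simp: eigenvector_def C_def[symmetric])
  have vv: "0 < v \<bullet> v"
    using conjugate_square_eq_0_vec[OF vc] v0
    by (simp add: order_less_le scalar_prod_def sum_nonneg)
  define t where "t = (\<Sum>x\<in>S. \<bar>v \<bullet> (x - \<mu>)\<bar>) / card S"
  have shift: "x \<bullet> v - \<mu> \<bullet> v = v \<bullet> (x - \<mu>)" if "x \<in> S" for x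
  proof -
    have x: "x \<in> carrier_vec D" using that S by auto
    show ?thesis
      using scalar_prod_minus_distrib[OF vc x \<mu>] comm_scalar_prod[OF vc x] comm_scalar_prod[OF vc \<mu>]
      by simp
  qed
  have "lam ! 0 * (v \<bullet> v) = (\<Sum>x\<in>S. (v \<bullet> (x - \<mu>))\<^sup>2) / card S"
    using quad[OF vc] vc by (simp add: Cv)
  \<comment> \<open>The hypothesis is applied with \<open>s\<close> equal to the projection of the
    mean. The eigenvector need not have length 1, which is why \<open>v \<bullet> v\<close> is
    carried along.\<close>
  also have "\<dots> \<le> c\<^sub>0 * t\<^sup>2"
    using moment[of "\<mu> \<bullet> v"] S unfolding p_def S_def[symmetric]
    by (simp add: integral_pmf_of_set shift t_def)
  finally have le: "lam ! 0 * (v \<bullet> v) \<le> c\<^sub>0 * t\<^sup>2" .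
  have "0 < c\<^sub>0 * t\<^sup>2"
    using mult_pos_pos[OF lam0 vv] le by (rule order_less_le_trans)
  then have "t \<noteq> 0"
    by (rule contrapos_pn) simp
  moreover have "0 \<le> t"
    unfolding t_def by (intro divide_nonneg_nonneg sum_nonneg abs_ge_zero of_nat_0_le_iff)
  ultimately have t: "0 < t"
    by simp
  \<comment> \<open>From \<open>V \<le> 2 * lam ! 0 * k\<close>; the next step is where
    \<open>c\<^sub>2 * (2 * c\<^sub>0) < 1\<close> enters.\<close>
  have "c\<^sub>2 * V / k \<le> c\<^sub>2 * (2 * lam ! 0)"
    using k c by (simp add: field_simps)
  also have "\<dots> < lam ! 0 / c\<^sub>0"
    using c lam0 by (simp add: field_simps)
  also have "\<dots> \<le> t\<^sup>2 / (v \<bullet> v)"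
    using le vv c by (simp add: field_simps)
  finally have "c\<^sub>2 * V / k < t\<^sup>2 / (v \<bullet> v)" .
  then show "\<exists>d'. 0 < d' \<and> d' \<le> k \<and>
      (avg_diam_coll X {A\<^sub>1, A\<^sub>2})\<^sup>2 < (1 - c\<^sub>2 / d') * (avg_diam X A)\<^sup>2"
    using k(1) decrease[OF vc t] by (intro exI[of _ k]) (simp add: t_def)
qed

theorem proposition4:
  fixes c c\<^sub>0 :: real
  assumes "c > 0" and "c\<^sub>0 \<ge> 1"
  shows "\<exists>c\<^sub>1 c\<^sub>2 :: real. 0 < c\<^sub>1 \<and> c\<^sub>1 < 1 \<and> 0 < c\<^sub>2 \<and> c\<^sub>2 < 1 \<and>
    (\<forall>(D :: nat) (\<X> :: real vec set) X A A\<^sub>1 A\<^sub>2 (d :: nat).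
       \<X> \<subseteq> carrier_vec D \<longrightarrow> X \<subseteq> \<X> \<longrightarrow> finite X \<longrightarrow> A \<subseteq> \<X> \<longrightarrow>
       avg_diam X A > 0 \<longrightarrow>
       (max_diam X A)\<^sup>2 \<le> c * (avg_diam X A)\<^sup>2 \<longrightarrow>
       two_means_split D X A A\<^sub>1 A\<^sub>2 \<longrightarrow>
       d \<ge> 1 \<longrightarrow>
       has_cov_dim D (pmf_of_set (A \<inter> X)) d c\<^sub>1 \<longrightarrow>
       (let p = pmf_of_set (A \<inter> X);
            ev = eigvals_desc (cov_mat D p);
            k = 1 / ev ! 0 * (\<Sum>i<d. ev ! i)
        in (\<exists>d' :: real. 0 < d' \<and> d' \<le> min (real d) (k\<^sup>2) \<and>
              (avg_diam_coll X {A\<^sub>1, A\<^sub>2})\<^sup>2 < (1 - c\<^sub>2 / d') * (avg_diam X A)\<^sup>2) \<and>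
           (\<forall>v. eigenvector (cov_mat D p) v (ev ! 0) \<longrightarrow>
              (\<forall>s :: real. measure_pmf.expectation p (\<lambda>x. (x \<bullet> v - s)\<^sup>2)
                 \<le> c\<^sub>0 * (measure_pmf.expectation p (\<lambda>x. \<bar>x \<bullet> v - s\<bar>))\<^sup>2) \<longrightarrow>
              (\<exists>d' :: real. 0 < d' \<and> d' \<le> k \<and>
                 (avg_diam_coll X {A\<^sub>1, A\<^sub>2})\<^sup>2 < (1 - c\<^sub>2 / d') * (avg_diam X A)\<^sup>2))))"
proof -
  \<comment> \<open>The denominators exceed 192 and 2 to make the required inequalities strict, and
    the term 1/2 keeps the constant below 1.\<close>
  define c\<^sub>2 where "c\<^sub>2 = min (1 / 2) (min (1 / (400 * c)) (1 / (4 * c\<^sub>0)))"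
  have c2: "0 < c\<^sub>2" "c\<^sub>2 < 1"
    using assms by (auto simp: c\<^sub>2_def)
  have "c\<^sub>2 \<le> 1 / (400 * c)" "c\<^sub>2 \<le> 1 / (4 * c\<^sub>0)"
    by (simp_all add: c\<^sub>2_def)
  then have "400 * (c\<^sub>2 * c) \<le> 1" "4 * (c\<^sub>2 * c\<^sub>0) \<le> 1"
    using assms by (simp_all add: field_simps)
  then have "c\<^sub>2 * (192 * c) < 1" "c\<^sub>2 * (2 * c\<^sub>0) < 1"
    by linarith+
  note decrease = two_means_decrease[OF assms c2(1) this]
  show ?thesis
    unfolding Let_def
  \<comment> \<open>Goals 1 to 4 are the ranges of the two constants; goals 5 and 6 are the two
    assertions about \<open>d'\<close>.\<close>
  proof (rule exI[of _ "1 / 2"], rule exI[of _ c\<^sub>2], intro conjI allI impI, goal_cases)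
    case (5 D \<X> X A A\<^sub>1 A\<^sub>2 d)
    then show ?case
      by (intro decrease(1)[where D = D]) blast+
  next
    case (6 D \<X> X A A\<^sub>1 A\<^sub>2 d v)
    then show ?case
      by (intro decrease(2)[where D = D and v = v]) blast+
  qed (use c2 in auto)
qed

end
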